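(* Let $1\le n_1\le n_2\le n_3\le n_4\le n_5$ be integers. For a set of indices $H\subseteq\{1,\dots,5\}$, written as a string of digits, put $\sigma(H)=\sum_{i\in H}n_i$ (for example $\sigma(13)=n_1+n_3$), and let $\wedge$ denote the minimum. Then \begin{align*} \operatorname{tdepth}\llbracket n_1\rrbracket&=\sigma(1),\\ \operatorname{tdepth}\llbracket n_1,n_2\rrbracket&=\sigma(2),\\ \operatorname{tdepth}\llbracket n_1,n_2,n_3\rrbracket&=\max\{\sigma(3),\ \sigma(12)\},\\ \operatorname{tdepth}\llbracket n_1,n_2,n_3,n_4\rrbracket&=\max\{\sigma(4),\ \sigma(24)\wedge\sigma(123)\},\\ \operatorname{tdepth}\llbracket n_1,n_2,n_3,n_4,n_5\rrbracket&=\max\{\sigma(5),\ \sigma(35)\wedge\sigma(1234),\ \sigma(45)\wedge\sigma(234)\wedge\sigma(135),\\ &\qquad\quad\ \sigma(45)\wedge\sigma(1234)\wedge\sigma(125),\ \sigma(125)\wedge\sigma(134)\}. \end{align*}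
   Context: For positive integers $n_1,\dots,n_k$, let $\llbracket n_1,\dots,n_k\rrbracket$ denote the poset of nonempty submultisets of the multiset $\{1^{n_1},\dots,k^{n_k}\}$ ordered by inclusion; equivalently, the set of nonzero tuples $(a_1,\dots,a_k)$ of integers with $0\le a_j\le n_j$ for all $j$, ordered componentwise. An interval in a finite poset $P$ is a set $[X,Y]=\{Z\in P: X\le Z\le Y\}$ with $X\le Y$ in $P$; $Y$ is its top element. An interval partition of $P$ is a partition of $P$ into nonempty pairwise disjoint intervals. The height of $Z\in P$ is the maximal size $n$ of a chain $Z=Z_1>Z_2>\cdots>Z_n$ in $P$ (in $\llbracket n_1,\dots,n_k\rrbracket$ the height of $(z_1,\dots,z_k)$ is $z_1+\cdots+z_k$). The total depth of an interval partition $\pi$ is $\operatorname{tdepth}\pi=\min_{[X,Y]\in\pi}\operatorname{height}Y$, and the total depth of $P$ is $\operatorname{tdepth}P=\max_\pi\operatorname{tdepth}\pi$ over all interval partitions $\pi$ of $P$. *)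

theory Defs
  imports "HOL-Library.Multiset" "HOL-Library.Disjoint_Sets"
begin

text \<open>A poset is given by a carrier \<open>P\<close> together with a reflexive order relation \<open>le\<close>.
  The functions \<open>Max\<close> and \<open>Min\<close> below are meaningful for a finite nonempty \<open>P\<close> only.\<close>

definition interval :: "'a set \<Rightarrow> ('a \<Rightarrow> 'a \<Rightarrow> bool) \<Rightarrow> 'a \<Rightarrow> 'a \<Rightarrow> 'a set" where
  "interval P le X Y = {Z \<in> P. le X Z \<and> le Z Y}"

definition interval_partition ::
    "'a set \<Rightarrow> ('a \<Rightarrow> 'a \<Rightarrow> bool) \<Rightarrow> 'a set set \<Rightarrow> bool" where
  "interval_partition P le \<pi> \<longleftrightarrow>
     partition_on P \<pi> \<and> (\<forall>I\<in>\<pi>. \<exists>X\<in>P. \<exists>Y\<in>P. le X Y \<and> I = interval P le X Y)"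

definition height :: "'a set \<Rightarrow> ('a \<Rightarrow> 'a \<Rightarrow> bool) \<Rightarrow> 'a \<Rightarrow> nat" where
  "height P le Z = Max {length zs | zs. set zs \<subseteq> P \<and> zs \<noteq> [] \<and> hd zs = Z \<and>
                          sorted_wrt (\<lambda>x y. le y x \<and> y \<noteq> x) zs}"

definition partition_tdepth ::
    "'a set \<Rightarrow> ('a \<Rightarrow> 'a \<Rightarrow> bool) \<Rightarrow> 'a set set \<Rightarrow> nat" where
  "partition_tdepth P le \<pi> =
     Min {height P le Y | X Y. X \<in> P \<and> Y \<in> P \<and> le X Y \<and> interval P le X Y \<in> \<pi>}"

definition tdepth :: "'a set \<Rightarrow> ('a \<Rightarrow> 'a \<Rightarrow> bool) \<Rightarrow> nat" where
  "tdepth P le = Max {partition_tdepth P le \<pi> | \<pi>. interval_partition P le \<pi>}"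

text \<open>The multiset \<open>{1^n\<^sub>1, \<dots>, k^n\<^sub>k}\<close> for \<open>ns = [n\<^sub>1, \<dots>, n\<^sub>k]\<close>
  (list positions start at \<open>0\<close>, the elements at \<open>1\<close>), and its nonempty submultisets.\<close>

definition power_mset :: "nat list \<Rightarrow> nat multiset" where
  "power_mset ns = (\<Sum>i<length ns. replicate_mset (ns ! i) (Suc i))"

definition nonempty_submultisets :: "nat list \<Rightarrow> nat multiset set" where
  "nonempty_submultisets ns = {A. A \<noteq> {#} \<and> A \<subseteq># power_mset ns}"

text \<open>The library order \<open>\<le>\<close> on multisets is not inclusion, hence the explicit \<open>\<subseteq>#\<close>.\<close>

definition mset_tdepth :: "nat list \<Rightarrow> nat" where
  "mset_tdepth ns = tdepth (nonempty_submultisets ns) (\<subseteq>#)"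

end

theory Submission
  imports Defs
begin

text \<open>
  Both bounds come from looking at supports. Write \<open>\<sigma>(H)\<close> for the total multiplicity of the
  elements of \<open>H\<close>, which is the height of the largest submultiset supported on \<open>H\<close>.

  Upper bound. The only nonempty submultiset of \<open>{#i#}\<close> is \<open>{#i#}\<close> itself, so in every interval
  partition \<open>{#i#}\<close> is the bottom of its interval; let \<open>Y i\<close> be the top. Draw an arc from \<open>i\<close> to each
  other element of \<open>Y i\<close>. No two arcs are opposite: if \<open>j \<in> Y i\<close> and \<open>i \<in> Y j\<close>, then \<open>{#i, j#}\<close>
  would lie in two intervals. If the depth is \<open>d\<close>, then \<open>\<sigma>(H) < d\<close> prevents \<open>Y i\<close> from being
  supported on \<open>H\<close>; hence every \<open>i \<in> H\<close> has an arc that leaves the light set \<open>H\<close>. A depth above the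
  claimed value makes so many sets light that no orientation of a graph on the elements allows this:
  that is \<open>mset_tdepth_le_last_or_rest\<close>, which suffices for up to three elements, and the
  \<open>no_orientation\<close> lemmas, which settle four and five elements by counting arcs.

  Lower bound. The support map onto the nonempty subsets of the underlying set pulls the Boolean
  interval \<open>[A, B]\<close> back to an interval whose top is the full restriction of the multiset to \<open>B\<close>, of
  height \<open>\<sigma>(B)\<close>. So every interval partition of the Boolean poset bounds the depth from below by
  the least \<open>\<sigma>(B)\<close> over its tops \<open>B\<close> (\<open>tdepth_ge_of_boolean_partition\<close>). A suitable Boolean
  partition for each term of each maximum shows that the bound above is attained.
\<close>

section \<open>Heights and depths of submultisets\<close>

abbreviation submultisets :: "'a multiset \<Rightarrow> 'a multiset set" where
  "submultisets M \<equiv> {A. A \<noteq> {#} \<and> A \<subseteq># M}"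

lemma finite_submultisets: "finite (submultisets M)"
proof -
  have "submultisets M \<subseteq> mset ` {zs. set zs \<subseteq> set_mset M \<and> length zs \<le> size M}"
  proof
    fix A assume "A \<in> submultisets M"
    moreover obtain zs where "A = mset zs" by (metis ex_mset)
    ultimately show "A \<in> mset ` {zs. set zs \<subseteq> set_mset M \<and> length zs \<le> size M}"
      using size_mset_mono[of A M] set_mset_mono[of A M] by (intro image_eqI[of _ _ zs]) auto
  qed
  then show ?thesis by (rule finite_subset) (simp add: finite_lists_length_le)
qed

lemma length_chain_le_size:
  assumes "sorted_wrt (\<lambda>A B. B \<subseteq># A \<and> B \<noteq> A) zs" and "zs \<noteq> []" and "{#} \<notin> set zs"
  shows "length zs \<le> size (hd zs)"
  using assms
proof (induction zs)
  case (Cons Z zs)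
  show ?case
  proof (cases zs)
    case Nil
    with Cons.prems show ?thesis by (simp add: Suc_le_eq nonempty_has_size)
  next
    case (Cons W ws)
    with Cons.prems have "W \<subset># Z" by (auto simp: subset_mset.less_le)
    then have "size W < size Z" by (rule mset_subset_size)
    moreover have "length zs \<le> size W"
      using Cons.IH Cons.prems Cons by auto
    ultimately show ?thesis by simp
  qed
qed simp

text \<open>
  Elements are removed one at a time. That all members of the chain are submultisets of \<open>Z\<close> is what
  lets the induction prepend the next multiset.
\<close>

lemma exists_chain_of_length_size:
  assumes "Z \<noteq> {#}"
  shows "\<exists>zs. hd zs = Z \<and> length zs = size Z \<and> set zs \<subseteq> submultisets Z \<and>
    sorted_wrt (\<lambda>A B. B \<subseteq># A \<and> B \<noteq> A) zs"
  using assms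
proof (induction Z)
  case (add x Z)
  show ?case
  proof (cases "Z = {#}")
    case True
    then show ?thesis by (intro exI[of _ "[{#x#}]"]) simp
  next
    case False
    with add.IH obtain zs where zs: "hd zs = Z" "length zs = size Z" "set zs \<subseteq> submultisets Z"
      "sorted_wrt (\<lambda>A B. B \<subseteq># A \<and> B \<noteq> A) zs" by blast
    have below: "A \<subseteq># add_mset x Z \<and> A \<noteq> add_mset x Z" if "A \<in> set zs" for A
    proof -
      from that zs(3) have "A \<subseteq># Z" by blast
      moreover have "Z \<subset># add_mset x Z" by simp
      ultimately have "A \<subset># add_mset x Z" by (rule subset_mset.le_less_trans)
      then show ?thesis by (simp add: subset_mset.less_le)
    qed
    show ?thesis
      using zs below by (intro exI[of _ "add_mset x Z # zs"]) auto
  qed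
qed simp

lemma height_submultisets:
  assumes "Z \<in> submultisets M"
  shows "height (submultisets M) (\<subseteq>#) Z = size Z"
  unfolding height_def
proof (rule Max_eqI)
  let ?L = "{length zs | zs. set zs \<subseteq> submultisets M \<and> zs \<noteq> [] \<and> hd zs = Z \<and>
    sorted_wrt (\<lambda>x y. y \<subseteq># x \<and> y \<noteq> x) zs}"
  show le: "m \<le> size Z" if "m \<in> ?L" for m
    using that length_chain_le_size by blast
  then show "finite ?L" by (intro finite_subset[of ?L "{..size Z}"]) auto
  obtain zs where zs: "hd zs = Z" "length zs = size Z" "set zs \<subseteq> submultisets Z"
    "sorted_wrt (\<lambda>A B. B \<subseteq># A \<and> B \<noteq> A) zs"
    using exists_chain_of_length_size assms by blast
  moreover have "zs \<noteq> []" using zs(2) assms by auto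
  moreover have "submultisets Z \<subseteq> submultisets M"
    using assms by (auto intro: subset_mset.order_trans)
  ultimately show "size Z \<in> ?L" by (intro CollectI exI[of _ zs]) auto
qed

lemma finite_heights:
  assumes "finite P"
  shows "finite {height P le Y | X Y. X \<in> P \<and> Y \<in> P \<and> le X Y \<and> interval P le X Y \<in> \<pi>}"
  by (rule finite_subset[of _ "height P le ` P"]) (use assms in auto)

lemma finite_tdepths:
  assumes "finite P"
  shows "finite {partition_tdepth P le \<pi> | \<pi>. interval_partition P le \<pi>}"
proof -
  have "{\<pi>. interval_partition P le \<pi>} \<subseteq> Pow (Pow P)"
    by (auto simp: interval_partition_def partition_on_def)
  then have "finite {\<pi>. interval_partition P le \<pi>}"
    by (rule finite_subset) (use assms in simp)
  then have "finite (partition_tdepth P le ` {\<pi>. interval_partition P le \<pi>})" by simp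
  then show ?thesis by (simp add: setcompr_eq_image)
qed

text \<open>Some interval partition exists, so that the maximum in the total depth is attained.\<close>

lemma singletons_interval_partition: 
  "interval_partition (submultisets M) (\<subseteq>#) ((\<lambda>A. {A}) ` submultisets M)"
proof -
  have "interval (submultisets M) (\<subseteq>#) A A = {A}" if "A \<in> submultisets M" for A
    using that by (auto simp: interval_def)
  then show ?thesis
    unfolding interval_partition_def partition_on_def
    by (auto simp: disjoint_def) 
qed

section \<open>Interval partitions orient the elements\<close>

definition escapes :: "('a \<Rightarrow> 'a \<Rightarrow> bool) \<Rightarrow> 'a set \<Rightarrow> 'a set \<Rightarrow> bool" where
  "escapes E V H \<longleftrightarrow> (\<forall>i\<in>H. \<exists>j\<in>V. j \<notin> H \<and> E i j)"

text \<open>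
  The arcs of \<open>E\<close> lead from \<open>i\<close> to the other elements of the top of the interval of \<open>{#i#}\<close> in an
  optimal partition. That top has size at least the depth, so it is not supported on a set \<open>H\<close> of
  smaller total multiplicity.
\<close>

lemma light_sets_escape_under_orientation:
  "\<exists>E. asymp E \<and> (\<forall>H \<subseteq> set_mset M.
    sum (count M) H < tdepth (submultisets M) (\<subseteq>#) \<longrightarrow> escapes E (set_mset M) H)"
proof -
  let ?P = "submultisets M"
  let ?D = "{partition_tdepth ?P (\<subseteq>#) \<pi> | \<pi>. interval_partition ?P (\<subseteq>#) \<pi>}"
  have "tdepth ?P (\<subseteq>#) \<in> ?D"
    unfolding tdepth_def using singletons_interval_partition
    by (intro Max_in finite_tdepths finite_submultisets) blast
  then obtain \<pi> where \<pi>: "interval_partition ?P (\<subseteq>#) \<pi>"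
    and depth: "tdepth ?P (\<subseteq>#) = partition_tdepth ?P (\<subseteq>#) \<pi>" by blast
  have "\<exists>Y. Y \<in> ?P \<and> i \<in># Y \<and> interval ?P (\<subseteq>#) {#i#} Y \<in> \<pi>" if "i \<in># M" for i
  proof -
    have "{#i#} \<in> \<Union>\<pi>"
      using \<pi> that by (simp add: interval_partition_def partition_on_def)
    then obtain X Y where XY: "X \<in> ?P" "Y \<in> ?P" "interval ?P (\<subseteq>#) X Y \<in> \<pi>"
      "{#i#} \<in> interval ?P (\<subseteq>#) X Y"
      using \<pi> by (auto simp: interval_partition_def)
    then have "X \<subseteq># {#i#}" "{#i#} \<subseteq># Y" "X \<noteq> {#}" by (simp_all add: interval_def)
    then have "X = {#i#}" by (simp add: nonempty_subseteq_mset_eq_single)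
    with XY \<open>{#i#} \<subseteq># Y\<close> show ?thesis by auto
  qed
  then have "\<forall>i\<in>set_mset M. \<exists>Y. Y \<in> ?P \<and> i \<in># Y \<and> interval ?P (\<subseteq>#) {#i#} Y \<in> \<pi>"
    by blast
  from bchoice[OF this] obtain Y where Y: "\<And>i. i \<in># M \<Longrightarrow> Y i \<in> ?P"
    "\<And>i. i \<in># M \<Longrightarrow> i \<in># Y i" "\<And>i. i \<in># M \<Longrightarrow> interval ?P (\<subseteq>#) {#i#} (Y i) \<in> \<pi>"
    by blast
  define E where "E = (\<lambda>i j. i \<in># M \<and> j \<in># M \<and> i \<noteq> j \<and> j \<in># Y i)"
  show ?thesis
  proof (intro exI[of _ E] conjI allI impI asympI)
    fix i j assume "E i j"
    then have ij: "i \<in># M" "j \<in># M" "i \<noteq> j" "j \<in># Y i" by (simp_all add: E_def)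
    show "\<not> E j i"
    proof
      assume "E j i"
      then have i: "i \<in># Y j" by (simp add: E_def)
      let ?I = "\<lambda>i. interval ?P (\<subseteq>#) {#i#} (Y i)"
      have pair: "{#i, j#} \<subseteq># A" if "i \<in># A" "j \<in># A" for A
        using that ij(3) by (auto simp: insert_subset_eq_iff in_diff_count)
      have "{#i, j#} \<in> ?I i \<inter> ?I j"
        using i ij Y(1)[of i] Y(2) pair[of "Y i"] pair[of "Y j"]
        by (auto simp: interval_def intro: subset_mset.order_trans)
      then have "?I i = ?I j"
        using Y(3)[OF ij(1)] Y(3)[OF ij(2)] \<pi>
        unfolding interval_partition_def partition_on_def disjoint_def by blast
      moreover have "{#i#} \<in> ?I i" using ij Y(2) by (simp add: interval_def)
      ultimately have "{#i#} \<in> ?I j" by simp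
      then show False using ij(3) by (simp add: interval_def)
    qed
  next
    fix H assume H: "H \<subseteq> set_mset M" "sum (count M) H < tdepth ?P (\<subseteq>#)"
    show "escapes E (set_mset M) H"
      unfolding escapes_def
    proof
      fix i assume "i \<in> H"
      with H(1) have i: "i \<in># M" by blast
      have "tdepth ?P (\<subseteq>#) \<le> height ?P (\<subseteq>#) (Y i)"
        unfolding depth partition_tdepth_def
        by (rule Min_le[OF finite_heights[OF finite_submultisets]], rule CollectI,
            rule exI[of _ "{#i#}"], rule exI[of _ "Y i"]) (use Y i in simp)
      also have "\<dots> = size (Y i)" by (rule height_submultisets[OF Y(1)[OF i]])
      also have "\<dots> \<le> sum (count M) (set_mset (Y i))"
        unfolding size_multiset_overloaded_eq
        using Y(1)[OF i] by (intro sum_mono) (simp add: mset_subset_eq_count)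
      finally have "sum (count M) H < sum (count M) (set_mset (Y i))" using H(2) by simp
      then have "\<not> set_mset (Y i) \<subseteq> H"
        using sum_mono2[of H "set_mset (Y i)" "count M"] H(1) finite_subset[OF H(1)] by auto
      then obtain j where "j \<in># Y i" "j \<notin> H" by blast
      then show "\<exists>j\<in>set_mset M. j \<notin> H \<and> E i j"
        using Y(1)[OF i] i \<open>i \<in> H\<close> by (intro bexI[of _ j]) (auto simp: E_def dest: mset_subset_eqD)
    qed
  qed
qed

section \<open>Pulling back Boolean interval partitions\<close>

text \<open>
  The family \<open>F\<close> lists the intervals by their bottoms and tops. Two Boolean intervals \<open>[A, B]\<close> and
  \<open>[A', B']\<close> meet iff \<open>A \<union> A' \<subseteq> B \<inter> B'\<close>, which explains the middle conjunct; in this form all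
  conditions can be checked by rewriting for an explicit \<open>F\<close>.
\<close>

definition boolean_partition :: "'a set \<Rightarrow> ('a set \<times> 'a set) set \<Rightarrow> bool" where
  "boolean_partition U F \<longleftrightarrow>
     (\<forall>(A, B) \<in> F. A \<noteq> {} \<and> A \<subseteq> B \<and> B \<subseteq> U) \<and>
     (\<forall>(A, B) \<in> F. \<forall>(A', B') \<in> F. A \<subseteq> B' \<and> A' \<subseteq> B \<longrightarrow> A = A' \<and> B = B') \<and>
     (\<forall>C \<in> Pow U. C \<noteq> {} \<longrightarrow> (\<exists>(A, B) \<in> F. A \<subseteq> C \<and> C \<subseteq> B))"

text \<open>
  The submultisets \<open>Z\<close> with \<open>A \<subseteq> set_mset Z \<subseteq> B\<close> form the interval from the multiset that has each
  element of \<open>A\<close> once to the restriction of \<open>M\<close> to \<open>B\<close>.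
\<close>

lemma tdepth_ge_of_boolean_partition:
  assumes M: "M \<noteq> {#}" and F: "boolean_partition (set_mset M) F"
    and d: "\<And>A B. (A, B) \<in> F \<Longrightarrow> d \<le> sum (count M) B"
  shows "d \<le> tdepth (submultisets M) (\<subseteq>#)"
proof -
  let ?P = "submultisets M"
  define lo where "lo = (\<lambda>p::'a set \<times> 'a set. mset_set (fst p))"
  define hi where "hi = (\<lambda>p::'a set \<times> 'a set. filter_mset (\<lambda>x. x \<in> snd p) M)"
  define \<pi> where "\<pi> = (\<lambda>p. interval ?P (\<subseteq>#) (lo p) (hi p)) ` F"
  have sub: "fst p \<noteq> {}" "fst p \<subseteq> snd p" "snd p \<subseteq> set_mset M" if "p \<in> F" for p
    using F that unfolding boolean_partition_def by (simp_all add: case_prod_beta)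
  have covered: "\<exists>p\<in>F. fst p \<subseteq> C \<and> C \<subseteq> snd p" if "C \<noteq> {}" "C \<subseteq> set_mset M" for C
    using F that unfolding boolean_partition_def case_prod_beta by simp
  have disjointD: "q = p" if "p \<in> F" "q \<in> F" "fst p \<subseteq> snd q" "fst q \<subseteq> snd p" for p q
    using F that unfolding boolean_partition_def case_prod_beta by (intro prod_eqI) blast+
  have fin: "finite (fst p)" "finite (snd p)" if "p \<in> F" for p
    using sub[OF that] by (meson finite_set_mset finite_subset)+
  have lo_le_iff: "lo p \<subseteq># Z \<longleftrightarrow> fst p \<subseteq> set_mset Z" if "p \<in> F" for p Z
    unfolding lo_def using fin(1)[OF that]
    by (auto simp: subseteq_mset_def count_mset_set' Suc_le_eq)
  have le_hi_iff: "Z \<subseteq># hi p \<longleftrightarrow> set_mset Z \<subseteq> snd p" if "Z \<subseteq># M" for p Z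
    using that unfolding hi_def by (auto simp: subseteq_mset_def count_eq_zero_iff dest: spec split: if_splits)
  have mem: "Z \<in> interval ?P (\<subseteq>#) (lo p) (hi p) \<longleftrightarrow> fst p \<subseteq> set_mset Z \<and> set_mset Z \<subseteq> snd p"
    if "p \<in> F" "Z \<in> ?P" for p Z
    using that lo_le_iff le_hi_iff by (auto simp: interval_def)
  have set_hi: "set_mset (hi p) = snd p" if "p \<in> F" for p
    using sub[OF that] by (auto simp: hi_def)
  have ends: "lo p \<in> ?P" "hi p \<in> ?P" "lo p \<subseteq># hi p" if "p \<in> F" for p
  proof -
    show "lo p \<subseteq># hi p" using lo_le_iff[OF that] set_hi[OF that] sub[OF that] by simp
    show "lo p \<in> ?P" using lo_le_iff[OF that, of M] sub[OF that] fin[OF that]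
      by (simp add: lo_def mset_set_empty_iff)
    show "hi p \<in> ?P" using set_hi[OF that] sub[OF that] by (auto simp: hi_def)
  qed
  have cover: "\<exists>!p. p \<in> F \<and> Z \<in> interval ?P (\<subseteq>#) (lo p) (hi p)" if "Z \<in> ?P" for Z
  proof -
    have "set_mset Z \<noteq> {}" "set_mset Z \<subseteq> set_mset M"
      using that by (auto dest: mset_subset_eqD)
    then obtain p where p: "p \<in> F" "fst p \<subseteq> set_mset Z" "set_mset Z \<subseteq> snd p"
      using covered by blast
    show ?thesis
    proof (rule ex1I[of _ p])
      show "p \<in> F \<and> Z \<in> interval ?P (\<subseteq>#) (lo p) (hi p)"
        using p mem[OF p(1) that] by blast
    next
      fix q assume q: "q \<in> F \<and> Z \<in> interval ?P (\<subseteq>#) (lo q) (hi q)"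
      then have "fst q \<subseteq> set_mset Z" "set_mset Z \<subseteq> snd q"
        using mem[of q, OF _ that] by blast+
      with p have "fst p \<subseteq> snd q" "fst q \<subseteq> snd p" by blast+
      with p q show "q = p" by (intro disjointD) blast+
    qed
  qed
  have inP: "interval ?P (\<subseteq>#) X Y \<subseteq> ?P" for X Y by (auto simp: interval_def)
  have "\<Union>\<pi> = ?P"
  proof
    show "\<Union>\<pi> \<subseteq> ?P" unfolding \<pi>_def using inP by blast
    show "?P \<subseteq> \<Union>\<pi>"
    proof
      fix Z assume "Z \<in> ?P"
      from cover[OF this] show "Z \<in> \<Union>\<pi>" unfolding \<pi>_def by blast
    qed
  qed
  moreover have "disjoint \<pi>"
  proof (rule disjointI)
    fix I J assume IJ: "I \<in> \<pi>" "J \<in> \<pi>" "I \<noteq> J"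
    show "I \<inter> J = {}"
    proof (rule equals0I)
      fix Z assume Z: "Z \<in> I \<inter> J"
      then have "Z \<in> ?P" using IJ(1) inP unfolding \<pi>_def by blast
      from cover[OF this] show False using Z IJ unfolding \<pi>_def by blast
    qed
  qed
  moreover have "{} \<notin> \<pi>"
  proof
    assume "{} \<in> \<pi>"
    then obtain p where "p \<in> F" "interval ?P (\<subseteq>#) (lo p) (hi p) = {}" by (auto simp: \<pi>_def)
    then show False using ends[of p] by (auto simp: interval_def)
  qed
  moreover have "\<forall>I\<in>\<pi>. \<exists>X\<in>?P. \<exists>Y\<in>?P. X \<subseteq># Y \<and> I = interval ?P (\<subseteq>#) X Y"
    unfolding \<pi>_def using ends by blast
  ultimately have part: "interval_partition ?P (\<subseteq>#) \<pi>"
    unfolding interval_partition_def partition_on_def by blast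
  \<comment> \<open>The depth ranges over all pairs that describe an interval, so such a pair first has to be
    identified with the one it came from; its top is determined by the interval.\<close>
  let ?H = "{height ?P (\<subseteq>#) Y | X Y. X \<in> ?P \<and> Y \<in> ?P \<and> X \<subseteq># Y \<and> interval ?P (\<subseteq>#) X Y \<in> \<pi>}"
  have "M \<in> ?P" using M by simp
  then obtain p where "p \<in> F" using cover by blast
  then have "?H \<noteq> {}" using ends[of p] unfolding \<pi>_def by blast
  moreover have "d \<le> h" if "h \<in> ?H" for h
  proof -
    from that obtain X Y p where XY: "h = height ?P (\<subseteq>#) Y" "X \<in> ?P" "Y \<in> ?P" "X \<subseteq># Y" and p: "p \<in> F"
      and eq: "interval ?P (\<subseteq>#) X Y = interval ?P (\<subseteq>#) (lo p) (hi p)"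
      unfolding \<pi>_def by blast
    have "Y \<in> interval ?P (\<subseteq>#) X Y" using XY by (simp add: interval_def)
    then have "Y \<subseteq># hi p" by (simp add: eq) (simp add: interval_def)
    moreover have "hi p \<in> interval ?P (\<subseteq>#) X Y"
      unfolding eq using ends[OF p] by (simp add: interval_def)
    then have "hi p \<subseteq># Y" by (simp add: interval_def)
    ultimately have "Y = hi p" by (rule subset_mset.antisym)
    have "d \<le> sum (count M) (snd p)" using d p by (cases p) simp
    also have "\<dots> = sum (count (hi p)) (set_mset (hi p))"
      unfolding set_hi[OF p] by (intro sum.cong) (auto simp: hi_def)
    also have "\<dots> = size (hi p)" by (simp add: size_multiset_overloaded_eq)
    also have "\<dots> = h" using height_submultisets[OF XY(3)] XY(1) \<open>Y = hi p\<close> by simp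
    finally show ?thesis .
  qed
  ultimately have "d \<le> partition_tdepth ?P (\<subseteq>#) \<pi>"
    unfolding partition_tdepth_def
    by (intro Min.boundedI finite_heights finite_submultisets)
  also have "\<dots> \<le> tdepth ?P (\<subseteq>#)"
    unfolding tdepth_def using part by (intro Max_ge finite_tdepths finite_submultisets) auto
  finally show ?thesis .
qed

section \<open>Multisets on an initial segment of the positive integers\<close>

lemma count_power_mset_map:
  "count (power_mset (map n [1..<Suc k])) x = (if x \<in> {1..k} then n x else 0)"
proof -
  have "count (power_mset (map n [1..<Suc k])) x = (\<Sum>i<k. if i = x - 1 \<and> 0 < x then n x else 0)"
    by (auto simp: power_mset_def count_sum simp del: upt_Suc intro!: sum.cong)
  also have "\<dots> = (if x \<in> {1..k} then n x else 0)"
    by (cases x) (auto simp: Suc_le_eq)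
  finally show ?thesis .
qed

lemma set_power_mset_map:
  assumes "\<forall>i\<in>{1..k}. 1 \<le> n i"
  shows "set_mset (power_mset (map n [1..<Suc k])) = {1..k}"
proof (rule set_eqI)
  fix x
  have "x \<in># power_mset (map n [1..<Suc k]) \<longleftrightarrow> x \<in> {1..k} \<and> n x \<noteq> 0"
    unfolding count_greater_zero_iff[symmetric] count_power_mset_map by auto
  then show "x \<in># power_mset (map n [1..<Suc k]) \<longleftrightarrow> x \<in> {1..k}"
    using assms by (metis not_one_le_zero)
qed

lemma sum_count_power_mset_map:
  "H \<subseteq> {1..k} \<Longrightarrow> sum (count (power_mset (map n [1..<Suc k]))) H = sum n H"
  by (intro sum.cong refl) (subst count_power_mset_map, auto)

lemma mset_tdepth_light_sets_escape:
  assumes "\<forall>i\<in>{1..k}. 1 \<le> n i"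
  shows "\<exists>E. asymp E \<and> (\<forall>H \<subseteq> {1..k}.
    sum n H < mset_tdepth (map n [1..<Suc k]) \<longrightarrow> escapes E {1..k} H)"
proof -
  let ?M = "power_mset (map n [1..<Suc k])"
  have V: "set_mset ?M = {1..k}" using assms by (rule set_power_mset_map)
  have d: "mset_tdepth (map n [1..<Suc k]) = tdepth (submultisets ?M) (\<subseteq>#)"
    unfolding mset_tdepth_def nonempty_submultisets_def ..
  obtain E where E: "asymp E" and escape: "\<And>H. H \<subseteq> {1..k} \<Longrightarrow>
      sum (count ?M) H < tdepth (submultisets ?M) (\<subseteq>#) \<Longrightarrow> escapes E {1..k} H"
    using light_sets_escape_under_orientation[of ?M] unfolding V by blast
  have "escapes E {1..k} H" if "H \<subseteq> {1..k}" "sum n H < mset_tdepth (map n [1..<Suc k])" for H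
    using that(2) by (intro escape[OF that(1)]) (simp only: d sum_count_power_mset_map[OF that(1)])
  with E show ?thesis by blast
qed

lemma mset_tdepth_ge:
  assumes "\<forall>i\<in>{1..k}. 1 \<le> n i" and "1 \<le> k"
    and F: "boolean_partition {1..k} F" and d: "\<forall>(A, B) \<in> F. d \<le> sum n B"
  shows "d \<le> mset_tdepth (map n [1..<Suc k])"
proof -
  let ?M = "power_mset (map n [1..<Suc k])"
  have V: "set_mset ?M = {1..k}" using assms(1) by (rule set_power_mset_map)
  have "d \<le> tdepth (submultisets ?M) (\<subseteq>#)"
  proof (rule tdepth_ge_of_boolean_partition)
    show "?M \<noteq> {#}" using V assms(2) by auto
    show "boolean_partition (set_mset ?M) F" using F V by simp
    fix A B assume AB: "(A, B) \<in> F"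
    then have "B \<subseteq> {1..k}" using F by (auto simp: boolean_partition_def)
    moreover have "d \<le> sum n B" using d AB by blast
    ultimately show "d \<le> sum (count ?M) B" by (simp only: sum_count_power_mset_map)
  qed
  then show ?thesis by (simp add: mset_tdepth_def nonempty_submultisets_def del: upt_Suc)
qed

text \<open>Classifying sets by their least element partitions them into intervals whose tops contain \<open>k\<close>.\<close>

lemma last_le_mset_tdepth:
  assumes "\<forall>i\<in>{1..k}. 1 \<le> n i" and "1 \<le> k"
  shows "n k \<le> mset_tdepth (map n [1..<Suc k])"
proof (rule mset_tdepth_ge[OF assms])
  let ?F = "(\<lambda>i. ({i}, {i..k})) ` {1..k}"
  have "\<exists>i\<in>{1..k}. i \<in> C \<and> C \<subseteq> {i..k}" if "C \<noteq> {}" "C \<subseteq> {1..k}" for C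
  proof -
    have "finite C" using that(2) by (rule finite_subset) simp
    then have "Min C \<in> C" using that(1) by (rule Min_in)
    moreover from this have "Min C \<in> {1..k}" using that(2) by blast
    ultimately show ?thesis
      using \<open>finite C\<close> that(2) by (intro bexI[of _ "Min C"]) auto
  qed
  then show "boolean_partition {1..k} ?F"
    unfolding boolean_partition_def by (auto simp: Ball_def)
  show "\<forall>(A, B) \<in> ?F. n k \<le> sum n B" by (auto intro: member_le_sum)
qed

text \<open>
  If \<open>{k}\<close> and its complement were both light, then some arc would leave \<open>k\<close>, while every other
  element would have its only possible escape, an arc to \<open>k\<close>.
\<close>

lemma mset_tdepth_le_last_or_rest:
  assumes "\<forall>i\<in>{1..k}. 1 \<le> n i" and "1 \<le> k"
  shows "mset_tdepth (map n [1..<Suc k]) \<le> max (n k) (sum n {1..<k})"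
proof (rule ccontr)
  assume "\<not> ?thesis"
  then have light: "sum n {k} < mset_tdepth (map n [1..<Suc k])"
      "sum n {1..<k} < mset_tdepth (map n [1..<Suc k])"
    by simp_all
  obtain E where E: "asymp E" and escape: "\<And>H. H \<subseteq> {1..k} \<Longrightarrow>
      sum n H < mset_tdepth (map n [1..<Suc k]) \<Longrightarrow> escapes E {1..k} H"
    using mset_tdepth_light_sets_escape[of k n, OF assms(1)] by blast
  have "escapes E {1..k} {k}" by (rule escape[OF _ light(1)]) (use assms(2) in simp)
  then obtain j where j: "j \<in> {1..k}" "j \<noteq> k" "E k j" by (auto simp: escapes_def)
  have "escapes E {1..k} {1..<k}" by (rule escape[OF _ light(2)]) auto
  moreover have "j \<in> {1..<k}" using j by auto
  ultimately obtain l where "l \<in> {1..k}" "l \<notin> {1..<k}" "E j l" unfolding escapes_def by blast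
  moreover from this have "l = k" by auto
  ultimately show False using j(3) E by (auto dest: asympD)
qed

section \<open>Orientations on four and five elements\<close>

text \<open>
  Call \<open>N(i)\<close> the set of \<open>i\<close> and the heads of its arcs; no \<open>N(i)\<close> is contained in a listed set that
  contains \<open>i\<close>. Every vertex lies in a listed set, so it has at least one arc. The following lemmas
  are finite propositional statements about the arcs, and each has a short counting argument.

  Here a vertex with a single arc must have \<open>N(i) = {3,4}\<close>, so there is at most one such vertex. The
  out-degrees then sum to at least \<open>2 + 2 + 2 + 1 = 7\<close>, but four vertices carry at most six arcs.
\<close>

lemma no_orientation_four:
  fixes E :: "nat \<Rightarrow> nat \<Rightarrow> bool"
  assumes E: "asymp E"
    and H: "\<forall>H \<in> {{1,2}, {1,3}, {1,4}, {2,3}, {2,4}}. escapes E {1,2,3,4} H"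
  shows False
proof -
  have "\<forall>i\<in>{1,2,3,4}. \<forall>j\<in>{1,2,3,4}. E i j \<longrightarrow> \<not> E j i"
    by (intro ballI impI asympD[OF E])
  note this[simplified] H[unfolded escapes_def, simplified]
  then show False by sat
qed

text \<open>
  As all pairs are listed, every out-degree is at least two. Five vertices carry at most ten arcs,
  so all out-degrees are exactly two and any two vertices are joined. The tail of the arc between \<open>1\<close>
  and \<open>2\<close> has \<open>N(i) = {1,2,x}\<close>, which is listed for each \<open>x\<close>.
\<close>

lemma no_orientation_five_pairs_125:
  fixes E :: "nat \<Rightarrow> nat \<Rightarrow> bool"
  assumes E: "asymp E"
    and H: "\<forall>H \<in> {{1,2}, {1,3}, {1,4}, {1,5}, {2,3}, {2,4}, {2,5}, {3,4}, {3,5},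
      {4,5}, {1,2,3}, {1,2,4}, {1,2,5}}. escapes E {1,2,3,4,5} H"
  shows False
proof -
  have "\<forall>i\<in>{1,2,3,4,5}. \<forall>j\<in>{1,2,3,4,5}. E i j \<longrightarrow> \<not> E j i"
    by (intro ballI impI asympD[OF E])
  note this[simplified] H[unfolded escapes_def, simplified]
  then show False by sat
qed

text \<open>
  Again all out-degrees, hence all in-degrees, are two, and any two vertices are joined. The tails of
  the arcs between \<open>1\<close> and \<open>2, 3, 4\<close> have three-element sets \<open>N(i)\<close> none of which is listed, which
  leaves \<open>{1,2,5}\<close>, \<open>{1,3,5}\<close> and \<open>{1,4,5}\<close>. Three is the number of sets \<open>N(i)\<close> that contain \<open>1\<close>,
  and also of those that contain \<open>5\<close>; so \<open>N(1)\<close> and \<open>N(5)\<close> are among them, and there are arcs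
  between \<open>1\<close> and \<open>5\<close> in both directions.
\<close>

lemma no_orientation_five_pairs_134:
  fixes E :: "nat \<Rightarrow> nat \<Rightarrow> bool"
  assumes E: "asymp E"
    and H: "\<forall>H \<in> {{1,2}, {1,3}, {1,4}, {1,5}, {2,3}, {2,4}, {2,5}, {3,4}, {3,5},
      {4,5}, {1,2,3}, {1,2,4}, {1,3,4}}. escapes E {1,2,3,4,5} H"
  shows False
proof -
  have "\<forall>i\<in>{1,2,3,4,5}. \<forall>j\<in>{1,2,3,4,5}. E i j \<longrightarrow> \<not> E j i"
    by (intro ballI impI asympD[OF E])
  note this[simplified] H[unfolded escapes_def, simplified]
  then show False by sat
qed

text \<open>
  Only the pair \<open>{4,5}\<close> is missing from the list, so at most one vertex has out-degree one. Every
  three-element subset of \<open>{1,2,3,4}\<close> is listed, so \<open>N(i) = {1,2,3,4}\<close> for each vertex \<open>i \<le> 4\<close>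
  without an arc to \<open>5\<close>; the head of any arc from \<open>5\<close> is such a vertex. As there are at most ten
  arcs, the out-degrees are \<open>3, 2, 2, 2, 1\<close> and any two vertices are joined. So \<open>5\<close> has a single
  arc, namely to \<open>4\<close>, and \<open>1, 2, 3\<close> have arcs to \<open>5\<close> and out-degree two. The tail of the arc between
  \<open>1\<close> and \<open>2\<close> has \<open>N(i) = {1,2,5}\<close>, which is listed.
\<close>

lemma no_orientation_five_125_234:
  fixes E :: "nat \<Rightarrow> nat \<Rightarrow> bool"
  assumes E: "asymp E"
    and H: "\<forall>H \<in> {{1,2}, {1,3}, {1,4}, {1,5}, {2,3}, {2,4}, {2,5}, {3,4}, {3,5},
      {1,2,3}, {1,2,4}, {1,2,5}, {1,3,4}, {2,3,4}}. escapes E {1,2,3,4,5} H"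
  shows False
proof -
  have "\<forall>i\<in>{1,2,3,4,5}. \<forall>j\<in>{1,2,3,4,5}. E i j \<longrightarrow> \<not> E j i"
    by (intro ballI impI asympD[OF E])
  note this[simplified] H[unfolded escapes_def, simplified]
  then show False by sat
qed

text \<open>
  At most one vertex has out-degree one, and its arc joins \<open>4\<close> and \<open>5\<close>; so there are nine or ten
  arcs. The tail of an arc between \<open>1\<close> and \<open>2\<close>, or \<open>1\<close> and \<open>3\<close>, has out-degree at least three,
  since all sets \<open>{1,2,x}\<close> and \<open>{1,3,x}\<close> are listed. With nine arcs the out-degrees are
  \<open>2, 2, 2, 2, 1\<close>, so both pairs would be unjoined, but only one pair is. With ten arcs one vertex of
  out-degree three is the tail for both pairs, so it is \<open>1\<close>, with arcs to \<open>2\<close>, \<open>3\<close> and \<open>x\<close>, where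
  \<open>{x, y} = {4, 5}\<close>; then \<open>y\<close> has an arc to \<open>1\<close>. The vertex of out-degree one is thus \<open>x\<close>, with its
  arc to \<open>y\<close>, and the second arc of \<open>y\<close> gives \<open>N(y) = {1,2,y}\<close> or \<open>N(y) = {1,3,y}\<close>.
\<close>

lemma no_orientation_five_125_135:
  fixes E :: "nat \<Rightarrow> nat \<Rightarrow> bool"
  assumes E: "asymp E"
    and H: "\<forall>H \<in> {{1,2}, {1,3}, {1,4}, {1,5}, {2,3}, {2,4}, {2,5}, {3,4}, {3,5},
      {1,2,3}, {1,2,4}, {1,2,5}, {1,3,4}, {1,3,5}}. escapes E {1,2,3,4,5} H"
  shows False
proof -
  have "\<forall>i\<in>{1,2,3,4,5}. \<forall>j\<in>{1,2,3,4,5}. E i j \<longrightarrow> \<not> E j i"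
    by (intro ballI impI asympD[OF E])
  note this[simplified] H[unfolded escapes_def, simplified]
  then show False by sat
qed

section \<open>Optimal Boolean partitions\<close>

text \<open>
  Each family is named after a list of sets of which every top dominates one: for some set \<open>H\<close> in the
  name, \<open>H\<close> maps injectively into the top without decreasing any element. For
  nondecreasing weights no top is then lighter than the lightest set in the name.
\<close>

definition tops_12 :: "(nat set \<times> nat set) set" where
  "tops_12 =
    {({1}, {1,2}), ({2}, {2,3}), ({3}, {1,3}),
     ({1,2,3}, {1,2,3})}"

lemma boolean_partition_tops_12: "boolean_partition {1,2,3} tops_12"
  unfolding boolean_partition_def tops_12_def Pow_insert Pow_empty by simp

definition tops_24_123 :: "(nat set \<times> nat set) set" where
  "tops_24_123 =
    {({1}, {1,2,4}), ({2}, {2,4}), ({3}, {1,2,3}),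
     ({4}, {3,4}), ({1,3,4}, {1,2,3,4}), ({2,3,4}, {2,3,4})}"

lemma boolean_partition_tops_24_123: "boolean_partition {1,2,3,4} tops_24_123"
  unfolding boolean_partition_def tops_24_123_def Pow_insert Pow_empty by simp

definition tops_35_1234 :: "(nat set \<times> nat set) set" where
  "tops_35_1234 =
    {({1}, {1,2,3,5}), ({2}, {2,3,5}), ({3}, {3,5}),
     ({4}, {1,2,3,4}), ({5}, {4,5}), ({1,4,5}, {1,2,3,4,5}),
     ({2,4,5}, {2,3,4,5}), ({3,4,5}, {3,4,5})}"

lemma boolean_partition_tops_35_1234: "boolean_partition {1,2,3,4,5} tops_35_1234"
  unfolding boolean_partition_def tops_35_1234_def Pow_insert Pow_empty by simp

definition tops_45_234_135 :: "(nat set \<times> nat set) set" where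
  "tops_45_234_135 =
    {({1}, {1,2,3,4}), ({2}, {2,4,5}), ({3}, {2,3,4}),
     ({4}, {4,5}), ({5}, {1,3,5}), ({1,2,5}, {1,2,3,4,5}),
     ({1,4,5}, {1,3,4,5}), ({2,3,5}, {2,3,4,5}), ({3,4,5}, {3,4,5})}"

lemma boolean_partition_tops_45_234_135: "boolean_partition {1,2,3,4,5} tops_45_234_135"
  unfolding boolean_partition_def tops_45_234_135_def Pow_insert Pow_empty by simp

definition tops_45_1234_125 :: "(nat set \<times> nat set) set" where
  "tops_45_1234_125 =
    {({1}, {1,2,5}), ({2}, {2,3,5}), ({3}, {1,3,5}),
     ({4}, {1,2,3,4}), ({5}, {4,5}), ({1,2,3}, {1,2,3,5}),
     ({1,4,5}, {1,2,3,4,5}), ({2,4,5}, {2,3,4,5}), ({3,4,5}, {3,4,5})}"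

lemma boolean_partition_tops_45_1234_125: "boolean_partition {1,2,3,4,5} tops_45_1234_125"
  unfolding boolean_partition_def tops_45_1234_125_def Pow_insert Pow_empty by simp

definition tops_125_134 :: "(nat set \<times> nat set) set" where
  "tops_125_134 =
    {({1}, {1,2,5}), ({2}, {2,3,4}), ({3}, {1,3,4}),
     ({4}, {1,4,5}), ({5}, {2,3,5}), ({1,2,3}, {1,2,3,4,5}),
     ({1,2,4}, {1,2,4,5}), ({1,3,5}, {1,3,4,5}), ({2,4,5}, {2,3,4,5}),
     ({3,4,5}, {3,4,5})}"

lemma boolean_partition_tops_125_134: "boolean_partition {1,2,3,4,5} tops_125_134"
  unfolding boolean_partition_def tops_125_134_def Pow_insert Pow_empty by simp

section \<open>The total depth for at most five elements\<close>

lemma mset_tdepth_two: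
  fixes n :: "nat \<Rightarrow> nat"
  assumes "1 \<le> n 1" and "n 1 \<le> n 2"
  shows "mset_tdepth [n 1, n 2] = n 2"
proof -
  have L: "map n [1..<Suc 2] = [n 1, n 2]" by (simp add: numeral_eq_Suc)
  have V: "{1..2} = {1, 2::nat}" by auto
  have pos: "\<forall>i\<in>{1..2}. 1 \<le> n i"
    unfolding V using assms by simp
  have "{1..<2} = {1::nat}" by auto
  then have "mset_tdepth [n 1, n 2] \<le> max (n 2) (n 1)"
    using mset_tdepth_le_last_or_rest[of 2 n, OF pos] unfolding L by simp
  moreover have "n 2 \<le> mset_tdepth [n 1, n 2]"
    using last_le_mset_tdepth[of 2 n, OF pos] unfolding L by simp
  ultimately show ?thesis using assms by simp
qed

lemma mset_tdepth_three:
  fixes n :: "nat \<Rightarrow> nat"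
  assumes "1 \<le> n 1" and "n 1 \<le> n 2" and "n 2 \<le> n 3"
  shows "mset_tdepth [n 1, n 2, n 3] = max (n 3) (n 1 + n 2)"
proof -
  have L: "map n [1..<Suc 3] = [n 1, n 2, n 3]" by (simp add: numeral_eq_Suc)
  have V: "{1..3} = {1, 2, 3::nat}" by auto
  have pos: "\<forall>i\<in>{1..3}. 1 \<le> n i"
    unfolding V using assms by simp
  have "{1..<3} = {1, 2::nat}" by auto
  then have "mset_tdepth [n 1, n 2, n 3] \<le> max (n 3) (n 1 + n 2)"
    using mset_tdepth_le_last_or_rest[of 3 n, OF pos] unfolding L by simp
  moreover have "n 3 \<le> mset_tdepth [n 1, n 2, n 3]"
    using last_le_mset_tdepth[of 3 n, OF pos] unfolding L by simp
  moreover have "n 1 + n 2 \<le> mset_tdepth [n 1, n 2, n 3]"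
  proof -
    have "\<forall>(A, B) \<in> tops_12. n 1 + n 2 \<le> sum n B"
      using assms unfolding tops_12_def by simp
    from mset_tdepth_ge[of 3 n, OF pos _ _ this] show ?thesis
      unfolding L V using boolean_partition_tops_12 by simp
  qed
  ultimately show ?thesis by simp
qed

lemma mset_tdepth_four:
  fixes n :: "nat \<Rightarrow> nat"
  assumes "1 \<le> n 1" and "n 1 \<le> n 2" and "n 2 \<le> n 3" and "n 3 \<le> n 4"
  shows "mset_tdepth [n 1, n 2, n 3, n 4] = max (n 4) (min (n 2 + n 4) (n 1 + n 2 + n 3))"
proof -
  let ?d = "mset_tdepth [n 1, n 2, n 3, n 4]"
  have L: "map n [1..<Suc 4] = [n 1, n 2, n 3, n 4]" by (simp add: numeral_eq_Suc)
  have V: "{1..4} = {1, 2, 3, 4::nat}" by auto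
  have pos: "\<forall>i\<in>{1..4}. 1 \<le> n i"
    unfolding V using assms by simp
  have "?d \<le> max (n 4) (min (n 2 + n 4) (n 1 + n 2 + n 3))"
  proof (rule ccontr)
    assume above: "\<not> ?thesis"
    have "{1..<4} = {1, 2, 3::nat}" by auto
    then have "?d \<le> max (n 4) (n 1 + n 2 + n 3)"
      using mset_tdepth_le_last_or_rest[of 4 n, OF pos] unfolding L by simp
    with above have light: "n 2 + n 4 < ?d" by linarith
    from mset_tdepth_light_sets_escape[of 4 n, OF pos, unfolded L V] obtain E where E: "asymp E"
      and light_escapes: "\<forall>H \<subseteq> {1, 2, 3, 4}. sum n H < ?d \<longrightarrow> escapes E {1, 2, 3, 4} H"
      by (elim exE conjE) (rule that)
    have escape: "\<forall>H \<in> L. escapes E {1, 2, 3, 4} H" if "\<forall>H \<in> L. H \<subseteq> {1, 2, 3, 4} \<and> sum n H < ?d" for L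
      using that light_escapes by blast
    show False
      by (rule no_orientation_four[OF E], rule escape) (use assms light in simp)
  qed
  moreover have "n 4 \<le> ?d"
    using last_le_mset_tdepth[of 4 n, OF pos] unfolding L by simp
  moreover have "min (n 2 + n 4) (n 1 + n 2 + n 3) \<le> ?d"
  proof -
    have "\<forall>(A, B) \<in> tops_24_123. min (n 2 + n 4) (n 1 + n 2 + n 3) \<le> sum n B"
      using assms unfolding tops_24_123_def by (simp add: min_def)
    from mset_tdepth_ge[of 4 n, OF pos _ _ this] show ?thesis
      unfolding L V using boolean_partition_tops_24_123 by simp
  qed
  ultimately show ?thesis by simp
qed

lemma mset_tdepth_five:
  fixes n :: "nat \<Rightarrow> nat"
  assumes "1 \<le> n 1" and "n 1 \<le> n 2" and "n 2 \<le> n 3" and "n 3 \<le> n 4" and "n 4 \<le> n 5"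
  defines "t1 \<equiv> min (n 3 + n 5) (n 1 + n 2 + n 3 + n 4)"
    and "t2 \<equiv> min (min (n 4 + n 5) (n 2 + n 3 + n 4)) (n 1 + n 3 + n 5)"
    and "t3 \<equiv> min (min (n 4 + n 5) (n 1 + n 2 + n 3 + n 4)) (n 1 + n 2 + n 5)"
    and "t4 \<equiv> min (n 1 + n 2 + n 5) (n 1 + n 3 + n 4)"
  shows "mset_tdepth [n 1, n 2, n 3, n 4, n 5] = Max {n 5, t1, t2, t3, t4}"
proof -
  let ?d = "mset_tdepth [n 1, n 2, n 3, n 4, n 5]"
  let ?V = "{1, 2, 3, 4, 5::nat}"
  have L: "map n [1..<Suc 5] = [n 1, n 2, n 3, n 4, n 5]" by (simp add: numeral_eq_Suc)
  have V: "{1..5} = ?V" by auto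
  have pos: "\<forall>i\<in>{1..5}. 1 \<le> n i"
    unfolding V using assms(1-5) by simp
  have "?d \<le> Max {n 5, t1, t2, t3, t4}"
  proof (rule ccontr)
    assume "\<not> ?thesis"
    then have above: "n 5 < ?d" "t1 < ?d" "t2 < ?d" "t3 < ?d" "t4 < ?d" by simp_all
    have "{1..<5} = {1, 2, 3, 4::nat}" by auto
    then have "?d \<le> max (n 5) (n 1 + n 2 + n 3 + n 4)"
      using mset_tdepth_le_last_or_rest[of 5 n, OF pos] unfolding L by simp
    with above have d_le: "?d \<le> n 1 + n 2 + n 3 + n 4" by linarith
    \<comment> \<open>The set \<open>{3,5}\<close> dominates all pairs except \<open>{4,5}\<close>, so these pairs are light too.\<close>
    have light: "n 3 + n 5 < ?d"
      using above(2) d_le unfolding t1_def by linarith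
    from mset_tdepth_light_sets_escape[of 5 n, OF pos, unfolded L V] obtain E where E: "asymp E"
      and light_escapes: "\<forall>H \<subseteq> ?V. sum n H < ?d \<longrightarrow> escapes E ?V H"
      by (elim exE conjE) (rule that)
    have escape: "\<forall>H \<in> L. escapes E ?V H" if "\<forall>H \<in> L. H \<subseteq> ?V \<and> sum n H < ?d" for L
      using that light_escapes by blast
    have "n 4 + n 5 < ?d \<or> n 2 + n 3 + n 4 < ?d \<or> n 1 + n 3 + n 5 < ?d"
      "n 4 + n 5 < ?d \<or> n 1 + n 2 + n 5 < ?d" "n 1 + n 2 + n 5 < ?d \<or> n 1 + n 3 + n 4 < ?d"
      using above(3-5) d_le unfolding t2_def t3_def t4_def min_less_iff_disj by auto
    then consider (pairs_125) "n 4 + n 5 < ?d" "n 1 + n 2 + n 5 < ?d"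
      | (pairs_134) "n 4 + n 5 < ?d" "n 1 + n 3 + n 4 < ?d"
      | (t125_234) "n 1 + n 2 + n 5 < ?d" "n 2 + n 3 + n 4 < ?d"
      | (t125_135) "n 1 + n 2 + n 5 < ?d" "n 1 + n 3 + n 5 < ?d"
      by blast
    then show False
    proof cases
      case pairs_125
      then show False
        by (intro no_orientation_five_pairs_125[OF E] escape) (use assms(1-5) light in simp)
    next
      case pairs_134
      then show False
        by (intro no_orientation_five_pairs_134[OF E] escape) (use assms(1-5) light in simp)
    next
      case t125_234
      then show False
        by (intro no_orientation_five_125_234[OF E] escape) (use assms(1-5) light in simp)
    next
      case t125_135
      then show False
        by (intro no_orientation_five_125_135[OF E] escape) (use assms(1-5) light in simp)
    qed
  qed
  moreover have "n 5 \<le> ?d"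
    using last_le_mset_tdepth[of 5 n, OF pos] unfolding L by simp
  moreover have ge: "t \<le> ?d" if "boolean_partition ?V F" "\<forall>(A, B) \<in> F. t \<le> sum n B" for t F
    using mset_tdepth_ge[of 5 n F t, OF pos _ _ that(2)] that(1) unfolding L V by simp
  have "t1 \<le> ?d"
    by (rule ge[OF boolean_partition_tops_35_1234])
      (use assms(1-5) in \<open>simp add: tops_35_1234_def t1_def min_def\<close>)
  moreover have "t2 \<le> ?d"
    by (rule ge[OF boolean_partition_tops_45_234_135])
      (use assms(1-5) in \<open>simp add: tops_45_234_135_def t2_def min_def\<close>)
  moreover have "t3 \<le> ?d"
    by (rule ge[OF boolean_partition_tops_45_1234_125])
      (use assms(1-5) in \<open>simp add: tops_45_1234_125_def t3_def min_def\<close>)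
  moreover have "t4 \<le> ?d"
    by (rule ge[OF boolean_partition_tops_125_134])
      (use assms(1-5) in \<open>simp add: tops_125_134_def t4_def min_def\<close>)
  ultimately show ?thesis by (intro antisym) simp_all
qed

theorem theorem7p1:
  fixes n :: "nat \<Rightarrow> nat"
  assumes "1 \<le> n 1" and "n 1 \<le> n 2" and "n 2 \<le> n 3" and "n 3 \<le> n 4" and "n 4 \<le> n 5"
  shows "mset_tdepth [n 1] = sum n {1} \<and>
    mset_tdepth [n 1, n 2] = sum n {2} \<and>
    mset_tdepth [n 1, n 2, n 3] = Max {sum n {3}, sum n {1,2}} \<and>
    mset_tdepth [n 1, n 2, n 3, n 4] =
      Max {sum n {4}, min (sum n {2,4}) (sum n {1,2,3})} \<and>
    mset_tdepth [n 1, n 2, n 3, n 4, n 5] =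
      Max {sum n {5},
           min (sum n {3,5}) (sum n {1,2,3,4}),
           min (min (sum n {4,5}) (sum n {2,3,4})) (sum n {1,3,5}),
           min (min (sum n {4,5}) (sum n {1,2,3,4})) (sum n {1,2,5}),
           min (sum n {1,2,5}) (sum n {1,3,4})}"
proof -
  have L: "map n [1..<Suc 1] = [n 1]" by simp
  have "mset_tdepth [n 1] = n 1"
    using mset_tdepth_le_last_or_rest[of 1 n] last_le_mset_tdepth[of 1 n] assms(1)
    unfolding L by (intro antisym) auto
  moreover have sums: "sum n {1} = n 1" "sum n {2} = n 2" "sum n {3} = n 3"
    "sum n {4} = n 4" "sum n {5} = n 5" "sum n {1,2} = n 1 + n 2"
    "sum n {2,4} = n 2 + n 4" "sum n {1,2,3} = n 1 + n 2 + n 3" "sum n {3,5} = n 3 + n 5"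
    "sum n {1,2,3,4} = n 1 + n 2 + n 3 + n 4" "sum n {4,5} = n 4 + n 5" "sum n {2,3,4} = n 2 + n 3 + n 4"
    "sum n {1,3,5} = n 1 + n 3 + n 5" "sum n {1,2,5} = n 1 + n 2 + n 5" "sum n {1,3,4} = n 1 + n 3 + n 4"
    by simp_all
  moreover have "Max {a, b} = max a b" for a b :: nat by simp
  ultimately show ?thesis
    using mset_tdepth_two[OF assms(1,2)] mset_tdepth_three[OF assms(1-3)]
      mset_tdepth_four[OF assms(1-4)] mset_tdepth_five[OF assms]
    by (simp only: conj_assoc)
qed

end
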